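(* Let $I \subset S=\mathbb{K}[x_1,\ldots,x_n]$ be an $\mathfrak{m}$-primary stable monomial ideal such that $x_n^{d} \in \mathcal{G}(I)$ for some positive integer $d$, and let $I=\bigcap_{i=1}^{r}\mathfrak{q}_i$ be an irredundant irreducible decomposition of $I$. Then for all $k\geq 1$: (a) $I^k\colon\mathfrak{m}^{kd-1}=\mathfrak{m}$; (b) $\mathrm{sat}(I^k)=k\cdot \mathrm{sat}(I)=kd$; (c) $\mathrm{sat}(I^k)=\max\{\mathrm{sat}(\mathfrak{q}_i^k) : i=1, \ldots , r\}=\mathrm{sat}(I^{\{k\}})$.
   Context: $\mathbb{K}$ is a field, $S=\mathbb{K}[x_1,\ldots,x_n]$ is the polynomial ring ($n\ge 1$) and $\mathfrak{m}=(x_1,\ldots,x_n)$. For ideals $I,J$ of $S$, $I\colon J=\{f\in S : fJ\subseteq I\}$, and $\mathfrak{m}^0=S$. The saturation number of an ideal $I\subset S$ is $\mathrm{sat}(I)=\min\{k\geq 0 : I\colon\mathfrak{m}^k=I\colon\mathfrak{m}^{k+1}\}$. $\mathcal{G}(I)$ denotes the unique set of minimal monomial generators of a monomial ideal $I$. For a monomial $u\neq 1$, $m(u)$ is the largest $j$ with $x_j\mid u$. A monomial ideal $I$ is stable if for all $u\in\mathcal{G}(I)$ and all $i<m(u)$ one has $x_iu/x_{m(u)}\in I$. An irreducible monomial ideal is one of the form $(x_{i_1}^{c_1},\ldots,x_{i_p}^{c_p})$ with distinct indices and all $c_j>0$. Every proper monomial ideal $I$ has a decomposition $I=\mathfrak{q}_1\cap\cdots\cap\mathfrak{q}_r$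 into irreducible monomial ideals that is irredundant (no $\mathfrak{q}_i$ can be omitted), unique up to order; the $\{k\}$-th symbolic power of $I$ is then defined by $I^{\{k\}}:=\bigcap_{i=1}^{r}\mathfrak{q}_i^k$. *)

theory Defs
  imports Complex_Main "HOL-Library.Poly_Mapping"
begin

text \<open>
  The polynomial ring in finitely many variables over a field \<open>'k\<close>.  The variables are indexed by
  a nonempty finite linear order \<open>'n\<close> (the role of \<open>1 < \<dots> < n\<close>); the last variable \<open>x\<^sub>n\<close> is the one
  with index \<open>Max UNIV\<close>.  An exponent vector is a \<open>'n \<Rightarrow>\<^sub>0 nat\<close>, and the multiplication of
  \<open>('n \<Rightarrow>\<^sub>0 nat) \<Rightarrow>\<^sub>0 'k\<close> is convolution, i.e. the usual product of polynomials.
\<close>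

type_synonym ('n, 'k) mpoly = "('n \<Rightarrow>\<^sub>0 nat) \<Rightarrow>\<^sub>0 'k"

definition monom :: "('n \<Rightarrow>\<^sub>0 nat) \<Rightarrow> ('n, 'k::field) mpoly"
  where "monom e = Poly_Mapping.single e 1"

definition X :: "'n \<Rightarrow> ('n, 'k::field) mpoly"
  where "X i = monom (Poly_Mapping.single i 1)"


subsection \<open>Ideals\<close>

text \<open>
  Ideals of a commutative ring are its submodules when it is regarded as a module over itself.  The
  locale \<open>module\<close> is interpreted only inside proofs, since its simplification rules for scalar
  multiplication would otherwise reorient every product.
\<close>

abbreviation is_ideal :: "'a::comm_ring_1 set \<Rightarrow> bool"
  where "is_ideal \<equiv> module.subspace (*)"

abbreviation ideal_span :: "'a::comm_ring_1 set \<Rightarrow> 'a set"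
  where "ideal_span \<equiv> module.span (*)"

definition ideal_mult :: "'a::comm_ring_1 set \<Rightarrow> 'a set \<Rightarrow> 'a set"
  where "ideal_mult I J = ideal_span {f * g | f g. f \<in> I \<and> g \<in> J}"

primrec ideal_power :: "'a::comm_ring_1 set \<Rightarrow> nat \<Rightarrow> 'a set"
  where
    "ideal_power I 0 = UNIV"
  | "ideal_power I (Suc k) = ideal_mult I (ideal_power I k)"

definition colon :: "'a::comm_ring_1 set \<Rightarrow> 'a set \<Rightarrow> 'a set"
  where "colon I J = {f. \<forall>g\<in>J. f * g \<in> I}"

definition radical :: "'a::comm_ring_1 set \<Rightarrow> 'a set"
  where "radical I = {f. \<exists>k. f ^ k \<in> I}"

definition primary :: "'a::comm_ring_1 set \<Rightarrow> bool"
  where "primary I \<longleftrightarrow> is_ideal I \<and> I \<noteq> UNIV \<and> (\<forall>f g. f * g \<in> I \<longrightarrow> f \<in> I \<or> g \<in> radical I)"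

definition maxideal :: "('n, 'k::field) mpoly set"
  where "maxideal = ideal_span (range X)"

definition m_primary :: "('n, 'k::field) mpoly set \<Rightarrow> bool"
  where "m_primary I \<longleftrightarrow> primary I \<and> radical I = maxideal"

text \<open>For finitely many variables the ring is Noetherian, so the minimum below exists for every ideal.\<close>

definition sat :: "('n, 'k::field) mpoly set \<Rightarrow> nat"
  where "sat I = (LEAST k. colon I (ideal_power maxideal k) = colon I (ideal_power maxideal (k + 1)))"


subsection \<open>Monomial ideals\<close>

definition monomial_ideal :: "('n, 'k::field) mpoly set \<Rightarrow> bool"
  where "monomial_ideal I \<longleftrightarrow> (\<exists>E. I = ideal_span (monom ` E))"

definition is_minimal_generators :: "('n, 'k::field) mpoly set \<Rightarrow> ('n, 'k) mpoly set \<Rightarrow> bool"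
  where "is_minimal_generators I G \<longleftrightarrow>
    G \<subseteq> range monom \<and> ideal_span G = I \<and> (\<forall>H. H \<subset> G \<longrightarrow> ideal_span H \<noteq> I)"

text \<open>Well defined on monomial ideals: see \<open>ex1_minimal_generators\<close> below.\<close>

definition minimal_generators :: "('n, 'k::field) mpoly set \<Rightarrow> ('n, 'k) mpoly set"
  where "minimal_generators I = (THE G. is_minimal_generators I G)"

text \<open>
  \<open>max_var e\<close> is only meaningful for \<open>e \<noteq> 0\<close>.  In the next definition the monomial \<open>x\<^sub>i u / x\<^bsub>m(u)\<^esub>\<close>
  is given by its exponent vector; the subtraction is never truncated, because \<open>m(u)\<close> occurs in \<open>u\<close>.
\<close>

definition max_var :: "('n::{finite,linorder} \<Rightarrow>\<^sub>0 nat) \<Rightarrow> 'n"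
  where "max_var e = Max (Poly_Mapping.keys e)"

definition stable :: "('n::{finite,linorder}, 'k::field) mpoly set \<Rightarrow> bool"
  where "stable I \<longleftrightarrow> monomial_ideal I \<and>
    (\<forall>e. e \<noteq> 0 \<and> monom e \<in> minimal_generators I \<longrightarrow>
      (\<forall>i < max_var e.
        monom (e - Poly_Mapping.single (max_var e) 1 + Poly_Mapping.single i 1) \<in> I))"

text \<open>
  The empty set of variables is allowed: it yields the zero ideal, which is its own irreducible
  decomposition.
\<close>

definition irreducible_monomial_ideal :: "('n, 'k::field) mpoly set \<Rightarrow> bool"
  where "irreducible_monomial_ideal Q \<longleftrightarrow>
    (\<exists>P c. (\<forall>i\<in>P. c i > (0::nat)) \<and> Q = ideal_span ((\<lambda>i. X i ^ c i) ` P))"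

definition irredundant_irreducible_decomposition ::
    "('n, 'k::field) mpoly set \<Rightarrow> nat \<Rightarrow> (nat \<Rightarrow> ('n, 'k) mpoly set) \<Rightarrow> bool"
  where "irredundant_irreducible_decomposition I r q \<longleftrightarrow>
    (\<forall>i\<in>{1..r}. irreducible_monomial_ideal (q i)) \<and>
    I = (\<Inter>i\<in>{1..r}. q i) \<and>
    (\<forall>j\<in>{1..r}. I \<noteq> (\<Inter>i\<in>{1..r} - {j}. q i))"

text \<open>
  Independent of the chosen decomposition: see \<open>symbolic_power_eq\<close> below.
\<close>

definition symbolic_power :: "('n, 'k::field) mpoly set \<Rightarrow> nat \<Rightarrow> ('n, 'k) mpoly set"
  where "symbolic_power I k =
    (THE J. \<exists>r q. irredundant_irreducible_decomposition I r q \<and>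
       J = (\<Inter>i\<in>{1..r}. ideal_power (q i) k))"


subsection \<open>Uniqueness of minimal generators and of irreducible components\<close>

lemma module_times: "module ((*) :: 'a::comm_ring_1 \<Rightarrow> 'a \<Rightarrow> 'a)"
  by unfold_locales (simp_all add: algebra_simps)

lemma monom_add: "monom (a + b) = monom a * monom b"
  by (simp add: monom_def mult_single)

lemma inj_monom: "inj (monom :: ('n \<Rightarrow>\<^sub>0 nat) \<Rightarrow> ('n, 'k::field) mpoly)"
proof (rule injI)
  fix a b :: "'n \<Rightarrow>\<^sub>0 nat"
  assume "(monom a :: ('n, 'k) mpoly) = monom b"
  then have "Poly_Mapping.keys (Poly_Mapping.single a (1::'k)) = Poly_Mapping.keys (Poly_Mapping.single b (1::'k))"
    by (simp add: monom_def)
  then show "a = b" by simp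
qed

lemma monom_eq_iff: "(monom a :: ('n, 'k::field) mpoly) = monom b \<longleftrightarrow> a = b"
  using inj_monom by (metis injD)

lemma X_power: "X i ^ c = monom (Poly_Mapping.single i c)"
proof (induction c)
  case 0
  then show ?case by (simp add: monom_def single_one)
next
  case (Suc c)
  have "Poly_Mapping.single i (Suc c) = Poly_Mapping.single i 1 + Poly_Mapping.single i c"
    by (simp add: single_add[symmetric])
  then show ?case by (metis Suc X_def monom_add power_Suc)
qed

lemma monomial_span_keys:
  assumes "f \<in> ideal_span (monom ` E)" and "e \<in> Poly_Mapping.keys (f :: ('n, 'k::field) mpoly)"
  shows "\<exists>a\<in>E. \<exists>c. e = a + c"
proof -
  interpret M: module "(*) :: ('n, 'k) mpoly \<Rightarrow> _ \<Rightarrow> _" by (rule module_times)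
  show ?thesis using assms
  proof (induction rule: M.span_induct_alt)
    case base
    then show ?case by simp
  next
    case (step c x y)
    from step.hyps obtain a where a: "a \<in> E" "x = monom a" by blast
    from step.prems have "e \<in> Poly_Mapping.keys (c * x) \<or> e \<in> Poly_Mapping.keys y"
      using keys_add[of "c * x" y] by blast
    then show ?case
    proof
      assume "e \<in> Poly_Mapping.keys (c * x)"
      moreover have "Poly_Mapping.keys x = {a}" by (simp add: a(2) monom_def)
      ultimately obtain b where "e = b + a" using keys_mult[of c x] by (auto dest!: subsetD)
      then have "e = a + b" by (simp only: add.commute)
      then show ?thesis using a(1) by blast
    next
      assume "e \<in> Poly_Mapping.keys y"
      then show ?thesis by (rule step.IH)
    qed
  qed
qed

lemma monom_in_monomial_span_iff:
  "(monom e :: ('n, 'k::field) mpoly) \<in> ideal_span (monom ` E) \<longleftrightarrow> (\<exists>a\<in>E. \<exists>c. e = a + c)"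
proof -
  interpret M: module "(*) :: ('n, 'k) mpoly \<Rightarrow> _ \<Rightarrow> _" by (rule module_times)
  show ?thesis
  proof
    assume "(monom e :: ('n, 'k) mpoly) \<in> ideal_span (monom ` E)"
    then show "\<exists>a\<in>E. \<exists>c. e = a + c"
      by (rule monomial_span_keys) (simp add: monom_def)
  next
    assume "\<exists>a\<in>E. \<exists>c. e = a + c"
    then obtain a c where "a \<in> E" "e = a + c" by blast
    moreover from this have "(monom e :: ('n, 'k) mpoly) = monom c * monom a"
      by (simp only: monom_add mult.commute)
    ultimately show "(monom e :: ('n, 'k) mpoly) \<in> ideal_span (monom ` E)"
      by (simp only: M.span_scale M.span_base imageI)
  qed
qed

lemma exponent_antisym:
  assumes "a = b + c" "b = a + (d :: 'n \<Rightarrow>\<^sub>0 nat)"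
  shows "a = b"
proof (rule poly_mapping_eqI)
  fix k
  have "Poly_Mapping.lookup a k = Poly_Mapping.lookup b k + Poly_Mapping.lookup c k"
    by (subst assms(1)) (rule lookup_add)
  moreover have "Poly_Mapping.lookup b k = Poly_Mapping.lookup a k + Poly_Mapping.lookup d k"
    by (subst assms(2)) (rule lookup_add)
  ultimately show "Poly_Mapping.lookup a k = Poly_Mapping.lookup b k" by linarith
qed

lemma exponent_minimal_below:
  fixes e :: "'n::finite \<Rightarrow>\<^sub>0 nat"
  assumes "P e"
  shows "\<exists>a c. P a \<and> e = a + c \<and> (\<forall>b d. P b \<longrightarrow> a = b + d \<longrightarrow> b = a)"
  using assms
proof (induction "\<Sum>i\<in>UNIV. Poly_Mapping.lookup e i" arbitrary: e rule: less_induct)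
  case less
  show ?case
  proof (cases "\<forall>b d. P b \<longrightarrow> e = b + d \<longrightarrow> b = e")
    case True
    then show ?thesis using less.prems by (metis add_0_right)
  next
    case False
    then obtain b d where b: "P b" "e = b + d" "b \<noteq> e" by blast
    then have "d \<noteq> 0" by auto
    then obtain j where "Poly_Mapping.lookup d j \<noteq> 0" by (metis lookup_zero poly_mapping_eqI)
    then have "(\<Sum>i\<in>UNIV. Poly_Mapping.lookup b i) < (\<Sum>i\<in>UNIV. Poly_Mapping.lookup e i)"
      using b(2) by (intro sum_strict_mono_ex1) (auto simp: lookup_add intro!: exI[of _ j])
    from less.hyps[OF this b(1)] show ?thesis
      using b(2) by (metis add.assoc)
  qed
qed

lemma minimal_generators_unique:
  assumes "is_minimal_generators I G"
  shows "G = monom ` {e. monom e \<in> I \<and> (\<forall>b d. (monom b :: ('n, 'k::field) mpoly) \<in> I \<longrightarrow> e = b + d \<longrightarrow> b = e)}"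
    (is "_ = monom ` ?A")
proof -
  interpret M: module "(*) :: ('n, 'k) mpoly \<Rightarrow> _ \<Rightarrow> _" by (rule module_times)
  obtain E where G: "G = monom ` E"
    using assms by (auto simp: is_minimal_generators_def subset_image_iff)
  have I: "I = ideal_span (monom ` E)"
    and irr: "\<And>H. H \<subset> G \<Longrightarrow> ideal_span H \<noteq> I"
    using assms G by (auto simp: is_minimal_generators_def)
  have sep: "a = e" if "a \<in> E" "e \<in> E" "e = a + c" for a e c
  proof (rule ccontr)
    assume "a \<noteq> e"
    then have "(monom e :: ('n, 'k) mpoly) \<in> ideal_span (monom ` (E - {e}))"
      using that by (subst monom_in_monomial_span_iff) blast
    then have "monom ` E \<subseteq> ideal_span (monom ` (E - {e}) :: ('n, 'k) mpoly set)"
      by (auto intro: M.span_base)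
    then have "ideal_span (monom ` (E - {e})) = I"
      unfolding I by (intro subset_antisym M.span_minimal M.span_mono) auto
    moreover have "monom ` (E - {e}) \<subset> G"
      using G that(2) inj_image_subset_iff[OF inj_monom, of E "E - {e}"] by blast
    ultimately show False using irr by blast
  qed
  have "E = ?A"
  proof (intro set_eqI iffI)
    fix e assume e: "e \<in> E"
    have "b = e" if b: "(monom b :: ('n, 'k) mpoly) \<in> I" "e = b + d" for b d
    proof -
      obtain a c where a: "a \<in> E" "b = a + c"
        using b(1) unfolding I monom_in_monomial_span_iff by blast
      then have "a = e" using sep[of a e "c + d"] e b(2) by (simp add: add.assoc)
      then show ?thesis using exponent_antisym a(2) b(2) by metis
    qed
    then show "e \<in> ?A" using e by (auto simp: I intro: M.span_base)
  next
    fix e assume e: "e \<in> ?A"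
    then obtain a c where a: "a \<in> E" "e = a + c"
      unfolding I monom_in_monomial_span_iff by blast
    then have "(monom a :: ('n, 'k) mpoly) \<in> I" by (auto simp: I intro: M.span_base)
    moreover have "\<And>b d. (monom b :: ('n, 'k) mpoly) \<in> I \<Longrightarrow> e = b + d \<Longrightarrow> b = e" using e by simp
    ultimately have "a = e" using a(2) by blast
    then show "e \<in> E" using a(1) by simp
  qed
  then show ?thesis using G by simp
qed

lemma ex1_minimal_generators:
  assumes "monomial_ideal (I :: ('n::finite, 'k::field) mpoly set)"
  shows "\<exists>!G. is_minimal_generators I G"
proof -
  interpret M: module "(*) :: ('n, 'k) mpoly \<Rightarrow> _ \<Rightarrow> _" by (rule module_times)
  obtain E where I: "I = ideal_span (monom ` E)" using assms by (auto simp: monomial_ideal_def)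
  define A where "A = {e. monom e \<in> I \<and> (\<forall>b d. (monom b :: ('n, 'k) mpoly) \<in> I \<longrightarrow> e = b + d \<longrightarrow> b = e)}"
  have "monom ` E \<subseteq> ideal_span (monom ` A :: ('n, 'k) mpoly set)"
  proof safe
    fix e assume "e \<in> E"
    then have "(monom e :: ('n, 'k) mpoly) \<in> I" by (auto simp: I intro: M.span_base)
    from exponent_minimal_below[of "\<lambda>e. (monom e :: ('n, 'k) mpoly) \<in> I", OF this]
    show "(monom e :: ('n, 'k) mpoly) \<in> ideal_span (monom ` A)"
      unfolding monom_in_monomial_span_iff A_def by blast
  qed
  moreover have "monom ` A \<subseteq> I" by (auto simp: A_def)
  ultimately have span: "ideal_span (monom ` A) = I"
    unfolding I by (simp add: subset_antisym M.span_minimal)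
  have "ideal_span H \<noteq> I" if sub: "H \<subset> monom ` A" for H
  proof
    assume H: "ideal_span H = I"
    obtain B where B: "H = monom ` B" "B \<subseteq> A" using sub by (meson psubset_imp_subset subset_imageE)
    then obtain e where e: "e \<in> A" "e \<notin> B" using sub by blast
    then have "(monom e :: ('n, 'k) mpoly) \<in> ideal_span (monom ` B)" using H B by (auto simp: A_def)
    then obtain b d where b: "b \<in> B" "e = b + d" unfolding monom_in_monomial_span_iff by blast
    then have "(monom b :: ('n, 'k) mpoly) \<in> I" using B(2) by (auto simp: A_def)
    then show False using e b by (auto simp: A_def)
  qed
  then have "is_minimal_generators I (monom ` A)"
    using span by (auto simp: is_minimal_generators_def)
  moreover have "G = monom ` A" if "is_minimal_generators I G" for G
    using minimal_generators_unique[OF that] by (simp only: A_def)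
  ultimately show ?thesis by blast
qed

lemma irreducible_imp_monomial:
  assumes "irreducible_monomial_ideal Q"
  shows "monomial_ideal Q"
proof -
  obtain P c where "Q = ideal_span ((\<lambda>i. X i ^ c i) ` P)"
    using assms by (auto simp: irreducible_monomial_ideal_def)
  then have "Q = ideal_span (monom ` ((\<lambda>i. Poly_Mapping.single i (c i)) ` P))"
    by (simp add: X_power image_image)
  then show ?thesis by (auto simp: monomial_ideal_def)
qed

lemma irreducible_meet_prime:
  fixes Q :: "('n::finite, 'k::field) mpoly set"
  assumes Q: "irreducible_monomial_ideal Q" and "finite F"
    and J: "\<And>j. j \<in> F \<Longrightarrow> monomial_ideal (J j)"
    and sub: "(\<Inter>j\<in>F. J j) \<subseteq> Q"
  shows "\<exists>j\<in>F. J j \<subseteq> Q"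
proof (rule ccontr)
  assume neg: "\<not> ?thesis"
  interpret M: module "(*) :: ('n, 'k) mpoly \<Rightarrow> _ \<Rightarrow> _" by (rule module_times)
  obtain P c where c: "\<forall>i\<in>P. c i > (0::nat)" and "Q = ideal_span ((\<lambda>i. X i ^ c i) ` P)"
    using Q by (auto simp: irreducible_monomial_ideal_def)
  then have Qeq: "Q = ideal_span (monom ` ((\<lambda>i. Poly_Mapping.single i (c i)) ` P))"
    by (simp add: X_power image_image)
  have memQ: "(monom e \<in> Q) = (\<exists>i\<in>P. c i \<le> Poly_Mapping.lookup e i)" for e
  proof
    assume "monom e \<in> Q"
    then obtain i d where "i \<in> P" "e = Poly_Mapping.single i (c i) + d"
      unfolding Qeq monom_in_monomial_span_iff by blast
    then show "\<exists>i\<in>P. c i \<le> Poly_Mapping.lookup e i"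
      by (intro bexI[of _ i]) (auto simp: lookup_add)
  next
    assume "\<exists>i\<in>P. c i \<le> Poly_Mapping.lookup e i"
    then obtain i where i: "i \<in> P" "c i \<le> Poly_Mapping.lookup e i" by blast
    have "e = Poly_Mapping.single i (c i) + (e - Poly_Mapping.single i (c i))"
      by (rule poly_mapping_eqI) (use i in \<open>auto simp: lookup_add lookup_minus lookup_single when_def\<close>)
    then show "monom e \<in> Q" unfolding Qeq monom_in_monomial_span_iff using i(1) by blast
  qed
  have "\<exists>u. monom u \<in> J j \<and> monom u \<notin> Q" if j: "j \<in> F" for j
  proof (rule ccontr)
    assume no: "\<not> ?thesis"
    obtain E where E: "J j = ideal_span (monom ` E)"
      using J[OF j] by (auto simp: monomial_ideal_def)
    have "monom ` E \<subseteq> Q" using no M.span_superset[of "monom ` E"] unfolding E by blast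
    then have "J j \<subseteq> Q" unfolding E by (intro M.span_minimal) (auto simp: Qeq)
    then show False using neg j by blast
  qed
  then obtain u where u: "\<And>j. j \<in> F \<Longrightarrow> monom (u j) \<in> J j" "\<And>j. j \<in> F \<Longrightarrow> monom (u j) \<notin> Q"
    by metis
  define e where "e = Abs_poly_mapping (\<lambda>i. Max (insert 0 ((\<lambda>j. Poly_Mapping.lookup (u j) i) ` F)))"
  have look: "Poly_Mapping.lookup e i = Max (insert 0 ((\<lambda>j. Poly_Mapping.lookup (u j) i) ` F))" for i
    by (simp add: e_def)
  have "monom e \<in> J j" if j: "j \<in> F" for j
  proof -
    obtain E where E: "J j = ideal_span (monom ` E)"
      using J[OF j] by (auto simp: monomial_ideal_def)
    obtain a d where a: "a \<in> E" "u j = a + d"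
      using u(1)[OF j] unfolding E monom_in_monomial_span_iff by blast
    have "e = u j + (e - u j)"
    proof (rule poly_mapping_eqI)
      fix k
      have "Poly_Mapping.lookup (u j) k \<le> Poly_Mapping.lookup e k"
        unfolding look by (rule Max_ge) (use \<open>finite F\<close> j in auto)
      then show "Poly_Mapping.lookup e k = Poly_Mapping.lookup (u j + (e - u j)) k" by (simp add: lookup_add lookup_minus)
    qed
    then have "e = a + (d + (e - u j))" using a(2) by (metis add.assoc)
    then show ?thesis unfolding E monom_in_monomial_span_iff using a(1) by blast
  qed
  then have "monom e \<in> Q" using sub by blast
  then obtain i where i: "i \<in> P" "c i \<le> Poly_Mapping.lookup e i" unfolding memQ by blast
  have "Poly_Mapping.lookup e i \<in> insert 0 ((\<lambda>j. Poly_Mapping.lookup (u j) i) ` F)"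
    unfolding look by (rule Max_in) (use \<open>finite F\<close> in auto)
  moreover have "Poly_Mapping.lookup e i \<noteq> 0" using c i by (metis le_zero_eq less_numeral_extra(3))
  ultimately obtain j where "j \<in> F" "Poly_Mapping.lookup e i = Poly_Mapping.lookup (u j) i" by blast
  then show False using u(2)[of j] i unfolding memQ by metis
qed

lemma decomposition_subset:
  fixes I :: "('n::finite, 'k::field) mpoly set"
  assumes "irredundant_irreducible_decomposition I r q"
    and "irredundant_irreducible_decomposition I s p"
  shows "q ` {1..r} \<subseteq> p ` {1..s}"
proof
  fix Q assume "Q \<in> q ` {1..r}"
  then obtain i where i: "i \<in> {1..r}" "Q = q i" by blast
  have q: "\<And>i. i \<in> {1..r} \<Longrightarrow> irreducible_monomial_ideal (q i)" "I = (\<Inter>i\<in>{1..r}. q i)"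
    and irr: "\<And>j. j \<in> {1..r} \<Longrightarrow> I \<noteq> (\<Inter>i\<in>{1..r} - {j}. q i)"
    using assms(1) unfolding irredundant_irreducible_decomposition_def by blast+
  have p: "\<And>i. i \<in> {1..s} \<Longrightarrow> irreducible_monomial_ideal (p i)" "I = (\<Inter>i\<in>{1..s}. p i)"
    using assms(2) unfolding irredundant_irreducible_decomposition_def by blast+
  have "(\<Inter>j\<in>{1..s}. p j) \<subseteq> q i" using q(2) p(2) i(1) by blast
  then obtain j where j: "j \<in> {1..s}" "p j \<subseteq> q i"
    using irreducible_meet_prime[OF q(1)[OF i(1)], of "{1..s}" p] p(1) irreducible_imp_monomial
    by blast
  have "(\<Inter>i\<in>{1..r}. q i) \<subseteq> p j" using q(2) p(2) j(1) by blast
  then obtain k where k: "k \<in> {1..r}" "q k \<subseteq> p j"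
    using irreducible_meet_prime[OF p(1)[OF j(1)], of "{1..r}" q] q(1) irreducible_imp_monomial
    by blast
  have "k = i"
  proof (rule ccontr)
    assume "k \<noteq> i"
    then have "(\<Inter>i\<in>{1..r} - {i}. q i) = (\<Inter>i\<in>{1..r}. q i)"
      using k j(2) i(1) by blast
    then show False using irr[OF i(1)] q(2) by simp
  qed
  then have "p j = q i" using k j by blast
  then show "Q \<in> p ` {1..s}" using i j by auto
qed

lemma symbolic_power_eq:
  fixes I :: "('n::finite, 'k::field) mpoly set"
  assumes "irredundant_irreducible_decomposition I r q"
  shows "symbolic_power I k = (\<Inter>i\<in>{1..r}. ideal_power (q i) k)"
  unfolding symbolic_power_def
proof (rule the_equality)
  show "\<exists>r' q'. irredundant_irreducible_decomposition I r' q' \<and>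
      (\<Inter>i\<in>{1..r}. ideal_power (q i) k) = (\<Inter>i\<in>{1..r'}. ideal_power (q' i) k)"
    using assms by blast
next
  fix J
  assume "\<exists>s p. irredundant_irreducible_decomposition I s p \<and> J = (\<Inter>i\<in>{1..s}. ideal_power (p i) k)"
  then obtain s p where p: "irredundant_irreducible_decomposition I s p"
    and J: "J = (\<Inter>i\<in>{1..s}. ideal_power (p i) k)" by blast
  have "p ` {1..s} = q ` {1..r}"
    using decomposition_subset[OF assms p] decomposition_subset[OF p assms] by blast
  then have "(\<lambda>Q. ideal_power Q k) ` (p ` {1..s}) = (\<lambda>Q. ideal_power Q k) ` (q ` {1..r})" by simp
  then show "J = (\<Inter>i\<in>{1..r}. ideal_power (q i) k)" unfolding J by (simp only: image_image)
qed

end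

theory Submission
  imports Defs
begin

text \<open>
  Stability trades the factors \<open>x\<^sub>n\<close> of \<open>x\<^sub>n\<^sup>d \<in> I\<close> one by one for arbitrary variables, so \<open>\<mm>\<^sup>d \<subseteq> I\<close>
  and hence \<open>\<mm>\<^bsup>kd\<^esup>\<close> lies in \<open>I\<^sup>k\<close>, in every \<open>\<qq>\<^sub>i\<^sup>k\<close> and in \<open>I\<^bsup>{k}\<^esup>\<close>.  Conversely, \<open>x\<^sub>n\<^bsup>d-1\<^esup>\<close>
  misses \<open>I\<close> and therefore some \<open>\<qq>\<^sub>i\<close>, and for a monomial ideal \<open>J\<close> without \<open>x\<^sub>n\<^bsup>d-1\<^esup>\<close> a power of \<open>x\<^sub>n\<close>
  can occur in an element of \<open>J\<^sup>k\<close> only with exponent at least \<open>kd\<close>.  Finally, once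
  \<open>J : \<mm>\<^sup>j = J : \<mm>\<^bsup>j+1\<^esup>\<close> the chain of colon ideals stays constant, so the saturation number of \<open>J\<close> is \<open>N\<close> as
  soon as \<open>\<mm>\<^sup>N \<subseteq> J\<close> but \<open>\<mm>\<^bsup>N-1\<^esup>\<close> is not contained in \<open>J\<close>.
\<close>

section \<open>Products and powers of ideals in a commutative ring\<close>

lemmas ideal_span_base = module.span_base[OF module_times]
  and ideal_span_mono = module.span_mono[OF module_times]
  and ideal_span_minimal = module.span_minimal[OF module_times]
  and ideal_span_scale = module.span_scale[OF module_times]
  and ideal_span_add = module.span_add[OF module_times]
  and ideal_span_zero = module.span_zero[OF module_times]
  and ideal_subspaceI = module.subspaceI[OF module_times]
  and ideal_subspace_def = module.subspace_def[OF module_times]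
  and ideal_subspace_diff = module.subspace_diff[OF module_times]
  and ideal_subspace_scale = module.subspace_scale[OF module_times]
  and ideal_subspace_Int = module.subspace_Int[OF module_times]
  and ideal_subspace_span = module.subspace_span[OF module_times]

lemma ideal_multI: "f \<in> A \<Longrightarrow> g \<in> B \<Longrightarrow> f * g \<in> ideal_mult A B"
  unfolding ideal_mult_def by (rule ideal_span_base) blast

lemma ideal_ideal_mult: "is_ideal (ideal_mult A B)"
  unfolding ideal_mult_def by (rule ideal_subspace_span)

lemma ideal_mult_least:
  assumes "is_ideal J" and "\<And>f g. f \<in> A \<Longrightarrow> g \<in> B \<Longrightarrow> f * g \<in> J"
  shows "ideal_mult A B \<subseteq> J"
  unfolding ideal_mult_def by (rule ideal_span_minimal) (use assms in auto)

lemma ideal_mult_mono: "A \<subseteq> A' \<Longrightarrow> B \<subseteq> B' \<Longrightarrow> ideal_mult A B \<subseteq> ideal_mult A' B'"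
  unfolding ideal_mult_def by (rule ideal_span_mono) blast

lemma ideal_UNIV: "is_ideal (UNIV :: 'a::comm_ring_1 set)"
  by (simp add: ideal_subspace_def)

lemma ideal_colon:
  assumes "is_ideal J"
  shows "is_ideal (colon J A)"
  using assms unfolding ideal_subspace_def colon_def by (simp add: algebra_simps)

text \<open>Colons into an ideal are ideals, so the hypothesis on generators extends to spans one
  factor at a time: first from \<open>A\<close> to its span, then, with the roles exchanged, from
  \<open>B\<close> to its span.\<close>

lemma span_mult_mem:
  assumes J: "is_ideal J" and AB: "\<And>a b. a \<in> A \<Longrightarrow> b \<in> B \<Longrightarrow> a * b \<in> J"
    and f: "f \<in> ideal_span A" and g: "g \<in> ideal_span B"
  shows "f * g \<in> J"
proof -
  have "A \<subseteq> colon J B" using AB by (auto simp: colon_def)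
  then have "ideal_span A \<subseteq> colon J B" by (rule ideal_span_minimal) (rule ideal_colon[OF J])
  then have "B \<subseteq> colon J (ideal_span A)" by (fastforce simp: colon_def mult.commute)
  then have "ideal_span B \<subseteq> colon J (ideal_span A)" by (rule ideal_span_minimal) (rule ideal_colon[OF J])
  then show ?thesis using f g by (auto simp: colon_def mult.commute)
qed

lemma ideal_mult_span:
  "ideal_mult (ideal_span A) (ideal_span B) = ideal_span {a * b | a b. a \<in> A \<and> b \<in> B}"
proof
  show "ideal_mult (ideal_span A) (ideal_span B) \<subseteq> ideal_span {a * b | a b. a \<in> A \<and> b \<in> B}"
    by (rule ideal_mult_least[OF ideal_subspace_span], erule (1) span_mult_mem[OF ideal_subspace_span, rotated])
      (blast intro: ideal_span_base)
  show "ideal_span {a * b | a b. a \<in> A \<and> b \<in> B} \<subseteq> ideal_mult (ideal_span A) (ideal_span B)"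
    unfolding ideal_mult_def by (rule ideal_span_mono) (blast intro: ideal_span_base)
qed

lemma ideal_mult_assoc_le:
  "ideal_mult A (ideal_mult B C) \<subseteq> ideal_mult (ideal_mult A B) C"
proof (rule ideal_mult_least[OF ideal_ideal_mult])
  fix a h assume a: "a \<in> A" and h: "h \<in> ideal_mult B C"
  show "a * h \<in> ideal_mult (ideal_mult A B) C"
  proof (rule span_mult_mem[OF ideal_ideal_mult])
    \<comment> \<open>Viewing \<open>a\<close> as a span of one generator reduces the claim to
      products \<open>a * (b * c)\<close>, where the ring's associativity applies.\<close>
    show "a \<in> ideal_span {a}" by (simp add: ideal_span_base)
    show "h \<in> ideal_span {b * c | b c. b \<in> B \<and> c \<in> C}" using h by (simp add: ideal_mult_def)
    show "x * y \<in> ideal_mult (ideal_mult A B) C"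
      if "x \<in> {a}" "y \<in> {b * c | b c. b \<in> B \<and> c \<in> C}" for x y
    proof -
      from that obtain b c where "x = a" "y = b * c" "b \<in> B" "c \<in> C" by blast
      then show ?thesis using a by (simp add: mult.assoc[symmetric] ideal_multI)
    qed
  qed
qed

lemma ideal_ideal_power: "is_ideal (ideal_power A k)"
  by (cases k) (simp_all add: ideal_ideal_mult ideal_UNIV)

lemma ideal_power_add_le:
  "ideal_power A (m + n) \<subseteq> ideal_mult (ideal_power A m) (ideal_power A n)"
proof (induction m)
  case 0
  then show ?case using ideal_multI[of 1 UNIV _ "ideal_power A n"] by auto
next
  case (Suc m)
  have "ideal_power A (Suc m + n) \<subseteq> ideal_mult A (ideal_mult (ideal_power A m) (ideal_power A n))"
    using Suc by (simp add: ideal_mult_mono)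
  also have "\<dots> \<subseteq> ideal_mult (ideal_power A (Suc m)) (ideal_power A n)"
    by (simp add: ideal_mult_assoc_le)
  finally show ?case .
qed

lemma ideal_power_mult_le:
  assumes "ideal_power A d \<subseteq> B"
  shows "ideal_power A (k * d) \<subseteq> ideal_power B k"
proof (induction k)
  case (Suc k)
  have "ideal_power A (Suc k * d) \<subseteq> ideal_mult (ideal_power A d) (ideal_power A (k * d))"
    using ideal_power_add_le by simp
  also have "\<dots> \<subseteq> ideal_power B (Suc k)" using Suc assms by (simp add: ideal_mult_mono)
  finally show ?case .
qed simp

lemma power_mem_ideal_power: "f \<in> A \<Longrightarrow> f ^ k \<in> ideal_power A k"
  by (induction k) (simp_all add: ideal_multI)

section \<open>Colon ideals and the saturation number\<close>

lemma colon_eq_UNIV_iff: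
  assumes "is_ideal J"
  shows "colon J A = UNIV \<longleftrightarrow> A \<subseteq> J"
proof
  assume "colon J A = UNIV"
  then have "1 \<in> colon J A" by simp
  then show "A \<subseteq> J" by (auto simp: colon_def)
next
  assume "A \<subseteq> J"
  then show "colon J A = UNIV" using assms by (auto simp: colon_def intro: ideal_subspace_scale)
qed

text \<open>Turns the colons by successive powers of \<open>A\<close> into a recursion: each is the
  colon of its predecessor by \<open>A\<close>.\<close>

lemma colon_ideal_mult:
  assumes J: "is_ideal J"
  shows "colon J (ideal_mult A B) = colon (colon J B) A"
proof (intro set_eqI iffI)
  fix f assume "f \<in> colon J (ideal_mult A B)"
  then show "f \<in> colon (colon J B) A"
    by (auto simp: colon_def mult.assoc ideal_multI)
next
  fix f assume f: "f \<in> colon (colon J B) A"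
  \<comment> \<open>Exchanging the roles of \<open>f\<close> and the product puts the product on the
    left of an inclusion into an ideal, so only its generators have to be tested.\<close>
  have "ideal_mult A B \<subseteq> colon J {f}"
    by (rule ideal_mult_least[OF ideal_colon[OF J]])
      (use f in \<open>auto simp: colon_def mult_ac\<close>)
  then show "f \<in> colon J (ideal_mult A B)" by (auto simp: colon_def mult.commute)
qed

text \<open>Each colon determines the next one, so a single repetition in the chain propagates
  forever.\<close>

lemma colon_power_stationary:
  assumes J: "is_ideal J"
    and eq: "colon J (ideal_power A j) = colon J (ideal_power A (j + 1))" and "j \<le> i"
  shows "colon J (ideal_power A i) = colon J (ideal_power A j)"
  using \<open>j \<le> i\<close>
proof (induction i rule: dec_induct)
  case (step i)
  have "colon J (ideal_power A (Suc i)) = colon (colon J (ideal_power A j)) A"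
    using step.IH by (simp add: colon_ideal_mult[OF J])
  also have "\<dots> = colon J (ideal_power A (j + 1))" by (simp add: colon_ideal_mult[OF J])
  finally show ?case by (simp only: eq)
qed simp

lemma sat_le:
  assumes J: "is_ideal J" and "ideal_power maxideal N \<subseteq> J"
  shows "sat J \<le> N"
  unfolding sat_def
proof (rule Least_le)
  have N: "colon J (ideal_power maxideal N) = UNIV"
    using assms by (simp add: colon_eq_UNIV_iff)
  then show "colon J (ideal_power maxideal N) = colon J (ideal_power maxideal (N + 1))"
    by (simp add: colon_ideal_mult[OF J]) (simp add: colon_def)
qed

text \<open>For \<open>N = 0\<close> the two inclusion hypotheses contradict each other, because \<open>N - 1 = N\<close>.\<close>

lemma sat_eqI:
  assumes J: "is_ideal J" and le: "ideal_power maxideal N \<subseteq> J"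
    and nle: "\<not> ideal_power maxideal (N - 1) \<subseteq> J"
  shows "sat J = N"
proof (rule antisym)
  show "sat J \<le> N" using J le by (rule sat_le)
next
  let ?c = "\<lambda>j. colon J (ideal_power maxideal j)"
  have N: "?c N = UNIV" using J le by (simp add: colon_eq_UNIV_iff)
  then have "?c N = ?c (N + 1)"
    by (simp add: colon_ideal_mult[OF J]) (simp add: colon_def)
  \<comment> \<open>\<open>N\<close> witnesses that the set under \<open>LEAST\<close> is nonempty,
    so its defining equation holds at \<open>sat J\<close>.\<close>
  then have st: "?c (sat J) = ?c (sat J + 1)" unfolding sat_def by (rule LeastI)
  show "N \<le> sat J"
  proof (rule ccontr)
    assume "\<not> N \<le> sat J"
    \<comment> \<open>Both \<open>N - 1\<close> and \<open>N\<close> lie in the stationary range,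
      since \<open>sat J < N\<close>.\<close>
    then have "?c (N - 1) = ?c (sat J)" "?c N = ?c (sat J)"
      by (auto intro!: colon_power_stationary[OF J st])
    then have "?c (N - 1) = UNIV" using N by simp
    then show False using J nle by (simp add: colon_eq_UNIV_iff)
  qed
qed

section \<open>The maximal ideal and colons equal to it\<close>

lemma X_in_maxideal: "X i \<in> maxideal"
  unfolding maxideal_def by (rule ideal_span_base) simp

lemma X_power_in_maxideal_power: "X i ^ k \<in> ideal_power maxideal k"
  by (rule power_mem_ideal_power) (rule X_in_maxideal)

lemma sat_eqI_X:
  assumes "is_ideal J" and "ideal_power maxideal N \<subseteq> J" and "X i ^ (N - 1) \<notin> J"
  shows "sat J = N"
proof (rule sat_eqI[OF assms(1,2)])
  show "\<not> ideal_power maxideal (N - 1) \<subseteq> J"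
    using assms(3) X_power_in_maxideal_power[of i "N - 1"] by (metis subsetD)
qed

lemma single_in_maxideal:
  assumes "e \<noteq> 0"
  shows "Poly_Mapping.single e c \<in> (maxideal :: ('n, 'k::field) mpoly set)"
proof -
  obtain i where i: "Poly_Mapping.lookup e i \<noteq> 0"
    using assms by (metis lookup_zero poly_mapping_eqI)
  have "e = (e - Poly_Mapping.single i 1) + Poly_Mapping.single i 1"
    by (rule poly_mapping_eqI) (use i in \<open>auto simp: lookup_add lookup_minus lookup_single when_def\<close>)
  then have "Poly_Mapping.single e c = Poly_Mapping.single (e - Poly_Mapping.single i 1) c * X i"
    unfolding X_def monom_def by (metis mult_single mult_1_right)
  then show ?thesis
    unfolding maxideal_def by (metis ideal_span_scale X_in_maxideal maxideal_def)
qed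

text \<open>Terms are added one at a time: a term with exponent zero joins the constant, any other
  is divisible by a variable.\<close>

lemma split_constant_term:
  fixes f :: "('n, 'k::field) mpoly"
  shows "\<exists>c. f - Poly_Mapping.single 0 c \<in> maxideal"
proof (induction f rule: update_induct)
  case const
  show ?case by (intro exI[of _ 0]) (simp add: maxideal_def ideal_span_zero)
next
  case (update f a b)
  then obtain c where c: "f - Poly_Mapping.single 0 c \<in> maxideal" by blast
  have upd: "Poly_Mapping.update a b f = f + Poly_Mapping.single a b"
    using update(1) by (intro poly_mapping_eqI)
      (auto simp: lookup_update lookup_add lookup_single when_def in_keys_iff)
  show ?case
  proof (cases "a = 0")
    case True
    then have "Poly_Mapping.update a b f - Poly_Mapping.single 0 (c + b) = f - Poly_Mapping.single 0 c"
      unfolding upd unfolding True by (simp add: single_add)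
    then show ?thesis using c by metis
  next
    case False
    have "(f - Poly_Mapping.single 0 c) + Poly_Mapping.single a b \<in> maxideal"
      using c single_in_maxideal[OF False, of b] unfolding maxideal_def by (rule ideal_span_add)
    then have "Poly_Mapping.update a b f - Poly_Mapping.single 0 c \<in> maxideal"
      by (simp add: upd algebra_simps)
    then show ?thesis by blast
  qed
qed

text \<open>Modulo \<open>maxideal\<close> every element of the colon is a constant that again lies
  in the colon. A nonzero constant would be a unit and force 1 into it, although
  \<open>X i ^ N\<close> shows that 1 is not there.\<close>

lemma colon_eq_maxideal:
  fixes J :: "('n, 'k::field) mpoly set"
  assumes J: "is_ideal J" and le: "ideal_power maxideal (Suc N) \<subseteq> J" and X: "X i ^ N \<notin> J"
  shows "colon J (ideal_power maxideal N) = maxideal"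
proof
  show ge: "maxideal \<subseteq> colon J (ideal_power maxideal N)"
    using le by (auto simp: colon_def intro: ideal_multI)
  show "colon J (ideal_power maxideal N) \<subseteq> maxideal"
  proof
    fix f assume f: "f \<in> colon J (ideal_power maxideal N)"
    obtain c where c: "f - Poly_Mapping.single 0 c \<in> maxideal" using split_constant_term by blast
    have "f - (f - Poly_Mapping.single 0 c) \<in> colon J (ideal_power maxideal N)"
      by (rule ideal_subspace_diff[OF ideal_colon[OF J] f subsetD[OF ge c]])
    then have "Poly_Mapping.single 0 c \<in> colon J (ideal_power maxideal N)" by simp
    then have "Poly_Mapping.single 0 (inverse c) * Poly_Mapping.single 0 c \<in> colon J (ideal_power maxideal N)"
      by (rule ideal_subspace_scale[OF ideal_colon[OF J]])
    moreover have "1 \<notin> colon J (ideal_power maxideal N)"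
      using X X_power_in_maxideal_power[of i N] by (auto simp: colon_def)
    ultimately have "c = 0" by (cases "c = 0") (simp_all add: mult_single single_one)
    then show "f \<in> maxideal" using c by simp
  qed
qed

section \<open>Lower bounds on the pure powers of one variable\<close>

text \<open>Setting all variables except the \<open>i\<close>-th to zero makes such a polynomial
  divisible by \<open>X i ^ N\<close>. The value \<open>j = 0\<close> accounts for the constant
  term.\<close>

definition pure_order_ge :: "'n \<Rightarrow> nat \<Rightarrow> ('n, 'k::field) mpoly set"
  where "pure_order_ge i N = {f. \<forall>j. Poly_Mapping.single i j \<in> Poly_Mapping.keys f \<longrightarrow> N \<le> j}"

text \<open>A pure power of one variable factors only into pure powers of that variable, because
  natural exponents with sum zero vanish. The two bounds therefore add.\<close>

lemma pure_order_ge_mult: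
  assumes "f \<in> pure_order_ge i M" and "g \<in> pure_order_ge i N"
  shows "f * g \<in> pure_order_ge i (M + N)"
  unfolding pure_order_ge_def
proof (intro CollectI allI impI)
  fix j assume "Poly_Mapping.single i j \<in> Poly_Mapping.keys (f * g)"
  then obtain a b where a: "a \<in> Poly_Mapping.keys f" and b: "b \<in> Poly_Mapping.keys g"
    and ab: "Poly_Mapping.single i j = a + b"
    using keys_mult[of f g] by blast
  have sum: "Poly_Mapping.lookup a k + Poly_Mapping.lookup b k = (j when i = k)" for k
    using ab by (metis lookup_add lookup_single)
  have "Poly_Mapping.lookup a k = 0" "Poly_Mapping.lookup b k = 0" if "k \<noteq> i" for k
    using sum[of k] that by (simp_all add: when_def)
  then have "a = Poly_Mapping.single i (Poly_Mapping.lookup a i)"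
    "b = Poly_Mapping.single i (Poly_Mapping.lookup b i)"
    by (auto intro!: poly_mapping_eqI simp: lookup_single when_def)
  then have "M \<le> Poly_Mapping.lookup a i" "N \<le> Poly_Mapping.lookup b i"
    using assms a b unfolding pure_order_ge_def by auto
  then show "M + N \<le> j" using sum[of i] by simp
qed

lemma ideal_pure_order_ge: "is_ideal (pure_order_ge i N :: ('n, 'k::field) mpoly set)"
proof (rule ideal_subspaceI)
  show "0 \<in> (pure_order_ge i N :: ('n, 'k) mpoly set)" by (simp add: pure_order_ge_def)
  show "f + g \<in> pure_order_ge i N" if "f \<in> pure_order_ge i N" "g \<in> pure_order_ge i N"
    for f g :: "('n, 'k) mpoly"
    using that keys_add[of f g] unfolding pure_order_ge_def by blast
  show "c * f \<in> pure_order_ge i N" if "f \<in> pure_order_ge i N" for c f :: "('n, 'k) mpoly"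
    \<comment> \<open>The bound 0 holds for every polynomial, so an arbitrary \<open>c\<close>
      serves as first factor.\<close>
    using pure_order_ge_mult[of c i 0 f N] that by (simp add: pure_order_ge_def)
qed

lemma monomial_ideal_pure_order_ge:
  fixes J :: "('n, 'k::field) mpoly set"
  assumes "monomial_ideal J" and "X i ^ (d - 1) \<notin> J"
  shows "J \<subseteq> pure_order_ge i d"
  unfolding pure_order_ge_def
proof (intro subsetI CollectI allI impI)
  fix f j assume f: "f \<in> J" and j: "Poly_Mapping.single i j \<in> Poly_Mapping.keys f"
  obtain E where E: "J = ideal_span (monom ` E)" using assms(1) by (auto simp: monomial_ideal_def)
  \<comment> \<open>In a monomial ideal every monomial occurring in an element belongs to the ideal
    itself.\<close>
  have Xj: "X i ^ j \<in> J"
    using monomial_span_keys[of f E, OF _ j] f unfolding E X_power monom_in_monomial_span_iff by blast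
  show "d \<le> j"
  proof (rule ccontr)
    assume "\<not> d \<le> j"
    then have "(X i :: ('n, 'k) mpoly) ^ (d - 1) = X i ^ (d - 1 - j) * X i ^ j"
      by (simp add: power_add[symmetric])
    then show False using Xj assms(2) E by (metis ideal_span_scale)
  qed
qed

lemma ideal_power_pure_order_ge:
  assumes "J \<subseteq> pure_order_ge i d"
  shows "ideal_power J k \<subseteq> pure_order_ge i (k * d)"
proof (induction k)
  case 0
  then show ?case by (simp add: pure_order_ge_def)
next
  case (Suc k)
  have "ideal_mult J (ideal_power J k) \<subseteq> pure_order_ge i (d + k * d)"
    using Suc assms by (intro ideal_mult_least ideal_pure_order_ge pure_order_ge_mult) blast+
  then show ?case by simp
qed

lemma X_power_notin_ideal_power:
  fixes J :: "('n, 'k::field) mpoly set"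
  assumes "monomial_ideal J" and "X i ^ (d - 1) \<notin> J" and "j < k * d"
  shows "X i ^ j \<notin> ideal_power J k"
proof
  assume "X i ^ j \<in> ideal_power J k"
  then have "(X i :: ('n, 'k) mpoly) ^ j \<in> pure_order_ge i (k * d)"
    using ideal_power_pure_order_ge[OF monomial_ideal_pure_order_ge[OF assms(1,2)]] by blast
  then have "k * d \<le> j" by (simp add: X_power monom_def pure_order_ge_def)
  then show False using assms(3) by simp
qed

section \<open>Stable ideals and the exchange of the last variable\<close>

lemma is_minimal_generators_minimal_generators:
  fixes I :: "('n::finite, 'k::field) mpoly set"
  assumes "monomial_ideal I"
  shows "is_minimal_generators I (minimal_generators I)"
  unfolding minimal_generators_def by (rule theI') (rule ex1_minimal_generators[OF assms])

lemma max_var_eq_Max: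
  fixes e :: "'n::{finite,linorder} \<Rightarrow>\<^sub>0 nat"
  assumes "Poly_Mapping.lookup e (Max UNIV) \<noteq> 0"
  shows "max_var e = Max UNIV"
  unfolding max_var_def by (rule Max_eqI) (use assms in \<open>auto simp: in_keys_iff\<close>)

text \<open>Extends the exchange from minimal generators to all monomials of \<open>I\<close>
  divisible by the last variable. A generator \<open>a\<close> dividing the monomial either avoids
  that variable, which then sits in the cofactor \<open>c\<close>, or has it as
  \<open>max_var a\<close>, so that stability applies to \<open>a\<close>.\<close>

lemma stable_exchange_last:
  fixes I :: "('n::{finite,linorder}, 'k::field) mpoly set"
  assumes st: "stable I" and e: "monom (e + Poly_Mapping.single (Max UNIV) 1) \<in> I"
  shows "monom (e + Poly_Mapping.single i 1) \<in> I"
proof (cases "i = Max UNIV")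
  case True
  then show ?thesis using e by simp
next
  case False
  let ?n = "Max UNIV :: 'n"
  have i: "i < ?n" using False by (simp add: order.not_eq_order_implies_strict)
  have mon: "monomial_ideal I" using st by (simp add: stable_def)
  then have "is_minimal_generators I (minimal_generators I)"
    by (rule is_minimal_generators_minimal_generators)
  then obtain E where E: "minimal_generators I = monom ` E" and I: "I = ideal_span (monom ` E)"
    unfolding is_minimal_generators_def by (metis subset_imageE)
  obtain a c where a: "a \<in> E" and ac: "e + Poly_Mapping.single ?n 1 = a + c"
    using e unfolding I monom_in_monomial_span_iff by blast
  have look: "Poly_Mapping.lookup e j + (1 when ?n = j) = Poly_Mapping.lookup a j + Poly_Mapping.lookup c j" for j
    using ac by (metis lookup_add lookup_single)
  show ?thesis
  proof (cases "Poly_Mapping.lookup a ?n = 0")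
    case True
    \<comment> \<open>By \<open>look\<close> and \<open>True\<close>, \<open>c\<close> has positive
      exponent at \<open>?n\<close>, so the subtraction is not truncated.\<close>
    have "e + Poly_Mapping.single i 1 = a + (c - Poly_Mapping.single ?n 1 + Poly_Mapping.single i 1)"
    proof (rule poly_mapping_eqI)
      fix j
      show "Poly_Mapping.lookup (e + Poly_Mapping.single i 1) j =
        Poly_Mapping.lookup (a + (c - Poly_Mapping.single ?n 1 + Poly_Mapping.single i 1)) j"
        using look[of j] True
        by (cases "j = ?n") (auto simp: lookup_add lookup_minus lookup_single when_def)
    qed
    then show ?thesis using a unfolding I monom_in_monomial_span_iff by blast
  next
    case nz: False
    then have m: "max_var a = ?n" by (rule max_var_eq_Max)
    have "a \<noteq> 0" using nz by auto
    then have "monom (a - Poly_Mapping.single ?n 1 + Poly_Mapping.single i 1) \<in> I"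
      using st a i m unfolding stable_def E by (metis imageI)
    then have "monom c * monom (a - Poly_Mapping.single ?n 1 + Poly_Mapping.single i 1) \<in> I"
      unfolding I by (rule ideal_span_scale)
    moreover have "e + Poly_Mapping.single i 1 = c + (a - Poly_Mapping.single ?n 1 + Poly_Mapping.single i 1)"
    proof (rule poly_mapping_eqI)
      fix j
      show "Poly_Mapping.lookup (e + Poly_Mapping.single i 1) j =
        Poly_Mapping.lookup (c + (a - Poly_Mapping.single ?n 1 + Poly_Mapping.single i 1)) j"
        using look[of j] nz
        by (cases "j = ?n") (auto simp: lookup_add lookup_minus lookup_single when_def)
    qed
    ultimately show ?thesis by (simp only: monom_add)
  qed
qed

lemma stable_maxideal_power_le:
  fixes I :: "('n::{finite,linorder}, 'k::field) mpoly set"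
  assumes st: "stable I" and X: "X (Max UNIV) ^ d \<in> I"
  shows "ideal_power maxideal d \<subseteq> I"
proof -
  let ?n = "Max UNIV :: 'n"
  \<comment> \<open>\<open>S j\<close> records the monomials that enter \<open>I\<close> after
    multiplication by the power \<open>d - j\<close> of the last variable. It contains 1 for
    \<open>j = 0\<close> and describes \<open>I\<close> itself for \<open>j = d\<close>.\<close>
  define S where "S j = {e. (monom (e + Poly_Mapping.single ?n (d - j)) :: ('n, 'k) mpoly) \<in> I}" for j
  obtain E where I: "I = ideal_span (monom ` E)"
    using st by (auto simp: stable_def monomial_ideal_def)
  have "ideal_power maxideal j \<subseteq> ideal_span (monom ` S j :: ('n, 'k) mpoly set)" if "j \<le> d" for j
    using that
  proof (induction j)
    case 0
    have "0 \<in> S 0" using X by (simp add: S_def X_power)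
    then have "(monom 0 :: ('n, 'k) mpoly) \<in> ideal_span (monom ` S 0)"
      by (intro ideal_span_base imageI)
    then have "f * monom 0 \<in> ideal_span (monom ` S 0)" for f :: "('n, 'k) mpoly"
      by (rule ideal_span_scale)
    then show ?case by (auto simp: monom_def single_one)
  next
    case (Suc j)
    have d: "d - j = Suc (d - Suc j)" using Suc.prems by simp
    \<comment> \<open>One of the \<open>d - j\<close> remaining copies of the last variable is
      exchanged for the new factor \<open>X i\<close>.\<close>
    have step: "Poly_Mapping.single i 1 + e \<in> S (Suc j)" if "e \<in> S j" for i e
    proof -
      have "(monom ((e + Poly_Mapping.single ?n (d - Suc j)) + Poly_Mapping.single ?n 1) :: ('n, 'k) mpoly) \<in> I"
        using that by (simp add: S_def d add.assoc single_add[symmetric])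
      then have "(monom ((e + Poly_Mapping.single ?n (d - Suc j)) + Poly_Mapping.single i 1) :: ('n, 'k) mpoly) \<in> I"
        by (rule stable_exchange_last[OF st])
      then show ?thesis by (simp add: S_def add_ac)
    qed
    have "ideal_power maxideal (Suc j) \<subseteq> ideal_mult maxideal (ideal_span (monom ` S j :: ('n, 'k) mpoly set))"
      using Suc by (simp add: ideal_mult_mono)
    also have "\<dots> = ideal_span {a * b | a b. a \<in> range X \<and> b \<in> monom ` S j}"
      unfolding maxideal_def by (rule ideal_mult_span)
    also have "\<dots> \<subseteq> ideal_span (monom ` S (Suc j))"
      using step by (intro ideal_span_mono) (auto simp: X_def monom_add[symmetric])
    finally show ?case .
  qed
  from this[of d] have "ideal_power maxideal d \<subseteq> ideal_span (monom ` S d :: ('n, 'k) mpoly set)" by simp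
  also have "\<dots> \<subseteq> I"
    unfolding I by (rule ideal_span_minimal[OF _ ideal_subspace_span]) (auto simp: S_def I)
  finally show ?thesis .
qed

text \<open>For \<open>d > 0\<close> this power is a proper divisor of a minimal generator, and no
  such divisor lies in \<open>I\<close>.\<close>

lemma X_pred_power_notin:
  fixes I :: "('n::finite, 'k::field) mpoly set"
  assumes "monomial_ideal I" and "d > 0" and "X i ^ d \<in> minimal_generators I"
  shows "X i ^ (d - 1) \<notin> I"
proof
  assume *: "X i ^ (d - 1) \<in> I"
  have "monom (Poly_Mapping.single i d) \<in> minimal_generators I" using assms(3) by (simp add: X_power)
  then have "\<forall>b c. (monom b :: ('n, 'k) mpoly) \<in> I \<longrightarrow> Poly_Mapping.single i d = b + c \<longrightarrow> b = Poly_Mapping.single i d"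
    by (simp add: minimal_generators_unique[OF is_minimal_generators_minimal_generators[OF assms(1)]]
        image_iff monom_eq_iff)
  moreover have "Poly_Mapping.single i d = Poly_Mapping.single i (d - 1) + Poly_Mapping.single i 1"
    using assms(2) by (simp add: single_add[symmetric])
  ultimately have "Poly_Mapping.single i (d - 1) = Poly_Mapping.single i d"
    using * by (metis X_power)
  then have "d - 1 = d" by (metis lookup_single_eq)
  then show False using assms(2) by simp
qed

theorem proposition2p8:
  fixes I :: "('n::{finite,linorder}, 'k::field) mpoly set"
    and q :: "nat \<Rightarrow> ('n, 'k) mpoly set"
    and d r :: nat
  assumes "monomial_ideal I" and "m_primary I" and "stable I"
    and "d > 0" and "X (Max UNIV) ^ d \<in> minimal_generators I"
    and "irredundant_irreducible_decomposition I r q"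
  shows "\<forall>k\<ge>1.
    colon (ideal_power I k) (ideal_power maxideal (k * d - 1)) = maxideal \<and>
    (sat (ideal_power I k) = k * sat I \<and> k * sat I = k * d) \<and>
    (sat (ideal_power I k) = Max {sat (ideal_power (q i) k) | i. i \<in> {1..r}} \<and>
     Max {sat (ideal_power (q i) k) | i. i \<in> {1..r}} = sat (symbolic_power I k))"
proof (intro allI impI)
  fix k :: nat assume k: "k \<ge> 1"
  let ?n = "Max UNIV :: 'n"
  have genI: "ideal_span (minimal_generators I) = I"
    using is_minimal_generators_minimal_generators[OF assms(1)]
    by (simp add: is_minimal_generators_def)
  have idI: "is_ideal I" using genI ideal_subspace_span by metis
  have Xd: "X ?n ^ d \<in> I" using assms(5) genI ideal_span_base by metis
  have Xd1: "X ?n ^ (d - 1) \<notin> I" using assms(1,4,5) by (rule X_pred_power_notin)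
  have mI: "ideal_power maxideal d \<subseteq> I" using assms(3) Xd by (rule stable_maxideal_power_le)
  have irr: "\<And>i. i \<in> {1..r} \<Longrightarrow> irreducible_monomial_ideal (q i)" and Iq: "I = (\<Inter>i\<in>{1..r}. q i)"
    using assms(6) unfolding irredundant_irreducible_decomposition_def by blast+
  have kd: "k * d - 1 < k * d" and Suc_kd: "Suc (k * d - 1) = k * d" using k assms(4) by simp_all

  have sup: "ideal_power maxideal (k * d) \<subseteq> ideal_power J k" if "I \<subseteq> J" for J
    using mI that by (intro ideal_power_mult_le) simp
  have notin: "X ?n ^ (k * d - 1) \<notin> ideal_power J k"
    if "monomial_ideal J" "X ?n ^ (d - 1) \<notin> J" for J :: "('n, 'k) mpoly set"
    using that kd by (rule X_power_notin_ideal_power)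

  have a: "colon (ideal_power I k) (ideal_power maxideal (k * d - 1)) = maxideal"
    using sup[of I] notin[OF assms(1) Xd1] Suc_kd
    by (intro colon_eq_maxideal[OF ideal_ideal_power]) auto
  have satIk: "sat (ideal_power I k) = k * d"
    using sup[of I] notin[OF assms(1) Xd1] by (intro sat_eqI_X[OF ideal_ideal_power]) auto
  have satI: "sat I = d" using idI mI Xd1 by (rule sat_eqI_X)

  \<comment> \<open>This component attains the maximum, and its power keeps
    \<open>X ?n ^ (k * d - 1)\<close> out of the symbolic power.\<close>
  obtain i0 where i0: "i0 \<in> {1..r}" "X ?n ^ (d - 1) \<notin> q i0" using Xd1 Iq by blast
  have sup_q: "ideal_power maxideal (k * d) \<subseteq> ideal_power (q i) k" if "i \<in> {1..r}" for i
    using that Iq by (intro sup) blast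
  have notin_q: "X ?n ^ (k * d - 1) \<notin> ideal_power (q i0) k"
    using irr[OF i0(1)] i0(2) by (intro notin irreducible_imp_monomial)
  have "sat (ideal_power (q i) k) \<le> k * d" if "i \<in> {1..r}" for i
    using sup_q[OF that] by (intro sat_le ideal_ideal_power)
  moreover have "sat (ideal_power (q i0) k) = k * d"
    using sup_q[OF i0(1)] notin_q by (intro sat_eqI_X[OF ideal_ideal_power])
  ultimately have "Max {sat (ideal_power (q i) k) | i. i \<in> {1..r}} = k * d"
    using i0(1) by (intro Max_eqI) (auto intro!: exI[of _ i0])
  moreover have "sat (symbolic_power I k) = k * d"
    \<comment> \<open>Evaluated on the given decomposition, the symbolic power is an intersection of
      ideals that all contain \<open>ideal_power maxideal (k * d)\<close>.\<close>
    unfolding symbolic_power_eq[OF assms(6)]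
    using sup_q notin_q i0(1)
    by (intro sat_eqI_X ideal_subspace_Int ideal_ideal_power) blast+
  ultimately show "colon (ideal_power I k) (ideal_power maxideal (k * d - 1)) = maxideal \<and>
    (sat (ideal_power I k) = k * sat I \<and> k * sat I = k * d) \<and>
    (sat (ideal_power I k) = Max {sat (ideal_power (q i) k) | i. i \<in> {1..r}} \<and>
     Max {sat (ideal_power (q i) k) | i. i \<in> {1..r}} = sat (symbolic_power I k))"
    using a satIk satI by simp
qed

end
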